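(* Let $G$ be a $d$-regular graph, $d\geq 7$, with girth $g(G)=5$ and diameter $\mathrm{diam}(G)=5$. Then $f(G)\geq \left\lceil \frac{d-1}{2}\right\rceil+4$.
   Context: Graphs are finite and simple. In a proper vertex coloring of a graph, a vertex of color $i$ is called dominant if it has a neighbor in each color class distinct from $i$ (that is, a neighbor of every available color other than its own). For a $d$-regular graph $G$, the $f$-chromatic vertex number $f(G)$ is the maximum number of dominant vertices of pairwise distinct colors in a proper coloring of $G$ with $d+1$ colors. *)

theory Defs
  imports "Graph_Theory.Graph_Theory" "HOL-Library.Extended_Nat"
begin

text \<open>
  A finite simple graph is an instance of the locale \<^locale>\<open>graph\<close>: a finite symmetric digraph
  without loops and parallel arcs, where each edge is represented by two opposite arcs.
\<close>

text \<open>Since there are no parallel arcs, the out-degree is the number of neighbours.\<close>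

definition regular :: "nat \<Rightarrow> ('a, 'b) pre_digraph \<Rightarrow> bool" where
  "regular d G \<longleftrightarrow> (\<forall>v\<in>verts G. out_degree G v = d)"

text \<open>
  The library's cycles include closed walks \<open>u, v, u\<close> of length 2 that run through both arcs
  of an edge; these are not cycles of the undirected graph, hence the bound 3. The girth of a
  forest is \<open>\<infinity>\<close>.
\<close>

definition girth :: "('a, 'b) pre_digraph \<Rightarrow> enat" where
  "girth G = (INF p \<in> {p. pre_digraph.cycle G p \<and> 3 \<le> length p}. enat (length p))"

text \<open>
  With unit weights, \<open>wf_digraph.\<mu>\<close> is the usual graph distance, the least number of edges of a
  walk from \<open>u\<close> to \<open>v\<close>; it is \<open>\<infinity>\<close> if there is no such walk. In particular a disconnected graph has
  infinite diameter.
\<close>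

definition diam :: "('a, 'b) pre_digraph \<Rightarrow> ereal" where
  "diam G = (SUP (u, v) \<in> verts G \<times> verts G. wf_digraph.\<mu> G (\<lambda>_. 1) u v)"

text \<open>The \<open>k\<close> available colors are \<open>0, \<dots>, k - 1\<close>; a coloring need not use all of them.\<close>

definition proper_coloring :: "('a, 'b) pre_digraph \<Rightarrow> nat \<Rightarrow> ('a \<Rightarrow> nat) \<Rightarrow> bool" where
  "proper_coloring G k c \<longleftrightarrow>
     (\<forall>v\<in>verts G. c v < k) \<and> (\<forall>u v. u \<rightarrow>\<^bsub>G\<^esub> v \<longrightarrow> c u \<noteq> c v)"

definition dominant :: "('a, 'b) pre_digraph \<Rightarrow> nat \<Rightarrow> ('a \<Rightarrow> nat) \<Rightarrow> 'a \<Rightarrow> bool" where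
  "dominant G k c v \<longleftrightarrow>
     v \<in> verts G \<and> (\<forall>i<k. i \<noteq> c v \<longrightarrow> (\<exists>w. v \<rightarrow>\<^bsub>G\<^esub> w \<and> c w = i))"

text \<open>
  The parameter \<open>d\<close> is the degree of the regular graph \<open>G\<close>. The set below is finite as \<open>G\<close> is, and
  nonempty because every \<open>d\<close>-regular graph has a proper coloring with \<open>d + 1\<close> colors.
\<close>

definition f_chromatic_vertex_number :: "nat \<Rightarrow> ('a, 'b) pre_digraph \<Rightarrow> nat" where
  "f_chromatic_vertex_number d G =
     Max {card S | S c. proper_coloring G (d + 1) c \<and>
       (\<forall>v\<in>S. dominant G (d + 1) c v) \<and> inj_on c S}"

end

theory Submission
  imports Defs
begin

text \<open>
  Write \<open>k = (d + 2) div 2\<close>. The bound \<open>\<lceil>(d - 1) / 2\<rceil> + 4\<close> equals \<open>k + 3\<close>, and \<open>k + 3\<close> dominant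
  vertices of distinct colors are found as follows.

  Fix a vertex \<open>x\<close> and use \<open>x\<close> together with its \<open>d\<close> neighbours as the set of colors, each of these
  vertices being colored by itself. A neighbour \<open>a\<close> of \<open>x\<close> becomes dominant if the set \<open>N a\<close> of its
  other neighbours receives bijectively the colors other than \<open>x\<close> and \<open>a\<close>. Since there are no
  triangles and no 4-cycles, the sets \<open>N a\<close> are independent and disjoint, and any two of them are
  joined by a matching. Hall's theorem therefore allows them to be colored one after the other
  (\<open>extend_star_coloring\<close>) as long as their number is at most \<open>k\<close>. Together with \<open>x\<close> this gives
  \<open>k + 1\<close> dominant vertices: \<open>x\<close> and a set \<open>K\<close> of \<open>k\<close> neighbours of \<open>x\<close>.

  The diameter provides a vertex \<open>y\<close> at distance 5 from \<open>x\<close>; let \<open>u\<close> be a neighbour of \<open>y\<close> and \<open>M\<close> the set of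
  the other neighbours of \<open>u\<close>. Then \<open>y\<close> and its neighbours have no edges to the vertices colored so
  far, and making \<open>u\<close> and \<open>y\<close> dominant with new colors amounts to a bijection from the closed
  neighbourhood of \<open>u\<close> to the colors in which \<open>u\<close> and \<open>y\<close> avoid \<open>x\<close> and \<open>K\<close>, and each \<open>w \<in> M\<close> avoids
  the colors that it sees in the sets \<open>N a\<close>. By the theorem of Frobenius and Koenig, the only possible
  obstruction consists of \<open>W \<subseteq> M\<close> and \<open>T \<subseteq> K\<close> with \<open>card W + card T \<ge> d\<close> such that every vertex of \<open>W\<close>
  sees every color of \<open>T\<close> (\<open>completable_if_no_block\<close>).

  If at most one vertex of \<open>M\<close> has neighbours in more than \<open>d - k\<close> of the sets \<open>N a\<close>, then no coloring
  of these sets leads to this obstruction (\<open>completable_if_few_high_reach\<close>). Otherwise two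
  vertices \<open>w\<close> and \<open>w'\<close> of \<open>M\<close> have neighbours in three common sets \<open>N a\<close>. Giving one color to the
  three neighbours of \<open>w\<close> and another one to two of the neighbours of \<open>w'\<close> makes these two colors
  visible from so few vertices of \<open>M\<close> that there is no obstruction either
  (\<open>completable_if_shared_reach\<close>). All remaining vertices are colored greedily.
\<close>

section \<open>Matchings that avoid a forbidden relation\<close>

text \<open>
  Hall's marriage theorem, by the argument of Halmos and Vaughan: if some proper subset is tight,
  it is matched separately from the rest; otherwise one element may be matched arbitrarily.
\<close>

lemma hall:
  fixes A :: "'x \<Rightarrow> 'y set"
  assumes "finite X" and "\<And>x. x \<in> X \<Longrightarrow> finite (A x)"
    and "\<And>S. S \<subseteq> X \<Longrightarrow> card S \<le> card (\<Union>(A ` S))"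
  shows "\<exists>f. inj_on f X \<and> (\<forall>x\<in>X. f x \<in> A x)"
  using assms
proof (induction X arbitrary: A rule: finite_psubset_induct)
  case (psubset X)
  note fin = psubset.prems(1) and cond = psubset.prems(2)
  consider "X = {}"
    | S where "S \<subset> X" "S \<noteq> {}" "card S = card (\<Union>(A ` S))"
    | x where "x \<in> X" "\<And>S. S \<subset> X \<Longrightarrow> S \<noteq> {} \<Longrightarrow> card S < card (\<Union>(A ` S))"
    using cond by (metis equals0I le_neq_implies_less psubset_imp_subset)
  then show ?case
  proof cases
    case 1
    then show ?thesis by simp
  next
    \<comment> \<open>A tight proper subset is matched on its own and exhausts its neighbourhood.\<close>
    case (2 S)
    define U where "U = \<Union>(A ` S)"
    obtain f where f: "inj_on f S" "\<forall>x\<in>S. f x \<in> A x"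
    proof -
      have "\<exists>f. inj_on f S \<and> (\<forall>x\<in>S. f x \<in> A x)"
      proof (rule psubset.IH[OF \<open>S \<subset> X\<close>])
        show "finite (A x)" if "x \<in> S" for x using that 2 fin by blast
        show "card S' \<le> card (\<Union>(A ` S'))" if "S' \<subseteq> S" for S' by (rule cond) (use that 2 in blast)
      qed
      then show ?thesis using that by blast
    qed
    have cond': "card S' \<le> card (\<Union>((\<lambda>x. A x - U) ` S'))" if S': "S' \<subseteq> X - S" for S'
    proof -
      have finS: "finite S" "finite S'" using 2 S' psubset.hyps finite_subset by blast+
      have "card S + card S' = card (S \<union> S')"
        using finS S' by (subst card_Un_disjoint) auto
      also have "\<dots> \<le> card (\<Union>(A ` (S \<union> S')))"
        by (rule cond) (use 2 S' in blast)
      also have "\<Union>(A ` (S \<union> S')) = U \<union> \<Union>((\<lambda>x. A x - U) ` S')" by (auto simp: U_def)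
      also have "card \<dots> \<le> card U + card (\<Union>((\<lambda>x. A x - U) ` S'))" by (rule card_Un_le)
      finally show ?thesis using 2 by (simp add: U_def)
    qed
    have "\<exists>g. inj_on g (X - S) \<and> (\<forall>x\<in>X - S. g x \<in> A x - U)"
    proof (rule psubset.IH)
      show "X - S \<subset> X" using 2 by blast
      show "finite (A x - U)" if "x \<in> X - S" for x using that fin by blast
    qed (rule cond')
    then obtain g where g: "inj_on g (X - S)" "\<forall>x\<in>X - S. g x \<in> A x - U" by blast
    have in_U: "f z \<in> U" if "z \<in> S" for z using that f by (auto simp: U_def)
    have not_in_U: "g z \<notin> U" if "z \<in> X" "z \<notin> S" for z using that g by blast
    have "inj_on (\<lambda>x. if x \<in> S then f x else g x) X"
    proof (rule inj_onI)
      fix z z' assume "z \<in> X" "z' \<in> X" "(if z \<in> S then f z else g z) = (if z' \<in> S then f z' else g z')"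
      then show "z = z'"
        using in_U[of z] in_U[of z'] not_in_U[of z] not_in_U[of z'] f(1) g(1)
        by (cases "z \<in> S"; cases "z' \<in> S") (auto dest: inj_onD)
    qed
    then show ?thesis using f g by (intro exI[of _ "\<lambda>x. if x \<in> S then f x else g x"]) auto
  next
    \<comment> \<open>Without tight subsets, any choice for one element leaves Hall's condition intact.\<close>
    case (3 x)
    have "card {x} \<le> card (A x)" using cond[of "{x}"] 3 by simp
    then obtain a where a: "a \<in> A x" by (cases "A x = {}") auto
    have cond': "card S \<le> card (\<Union>((\<lambda>z. A z - {a}) ` S))" if S: "S \<subseteq> X - {x}" for S
    proof (cases "S = {}")
      case False
      have "card S < card (\<Union>(A ` S))" using 3 S False by blast
      moreover have "\<Union>((\<lambda>z. A z - {a}) ` S) = \<Union>(A ` S) - {a}" by auto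
      moreover have "card (\<Union>(A ` S)) - 1 \<le> card (\<Union>(A ` S) - {a})"
        using diff_card_le_card_Diff[of "{a}" "\<Union>(A ` S)"] by simp
      ultimately show ?thesis by simp
    qed simp
    have "\<exists>f. inj_on f (X - {x}) \<and> (\<forall>z\<in>X - {x}. f z \<in> A z - {a})"
    proof (rule psubset.IH)
      show "X - {x} \<subset> X" using 3 by blast
      show "finite (A z - {a})" if "z \<in> X - {x}" for z using that fin by blast
    qed (rule cond')
    then obtain f where f: "inj_on f (X - {x})" "\<forall>z\<in>X - {x}. f z \<in> A z - {a}" by blast
    have "inj_on (\<lambda>z. if z = x then a else f z) X"
      using f by (auto simp: inj_on_def)
    then show ?thesis using f a by (intro exI[of _ "\<lambda>z. if z = x then a else f z"]) auto
  qed
qed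

text \<open>
  The form of Hall's theorem that suits a coloring in which every color is to be used exactly once:
  such a bijection can only be obstructed by a completely forbidden block that is too large.
\<close>

lemma frobenius_koenig:
  assumes fin: "finite X" "finite Y" and card: "card X = card Y"
    and no_block: "\<And>S T. S \<subseteq> X \<Longrightarrow> T \<subseteq> Y \<Longrightarrow> (\<And>s t. s \<in> S \<Longrightarrow> t \<in> T \<Longrightarrow> R s t)
      \<Longrightarrow> card S + card T \<le> card X"
  shows "\<exists>f. bij_betw f X Y \<and> (\<forall>x\<in>X. \<not> R x (f x))"
proof -
  define A where "A x = {y \<in> Y. \<not> R x y}" for x
  have "card S \<le> card (\<Union>(A ` S))" if S: "S \<subseteq> X" for S
  proof -
    have sub: "\<Union>(A ` S) \<subseteq> Y" by (auto simp: A_def)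
    have "card S + card (Y - \<Union>(A ` S)) \<le> card X"
      by (rule no_block[OF S]) (auto simp: A_def)
    moreover have "card (Y - \<Union>(A ` S)) = card Y - card (\<Union>(A ` S))"
      using sub fin by (simp add: card_Diff_subset finite_subset)
    moreover have "card (\<Union>(A ` S)) \<le> card Y" using sub fin by (simp add: card_mono)
    ultimately show ?thesis using card by linarith
  qed
  moreover have "finite (A x)" for x using fin by (simp add: A_def)
  ultimately obtain f where f: "inj_on f X" "\<forall>x\<in>X. f x \<in> A x"
    using hall[of X A] fin by blast
  have "f ` X = Y"
    using f fin card by (intro card_subset_eq) (auto simp: A_def card_image)
  then show ?thesis using f by (intro exI[of _ f]) (auto simp: bij_betw_def A_def)
qed

text \<open>
  A forbidden block \<open>S \<times> T\<close> has \<open>card S \<le> s\<close> and \<open>card T \<le> s\<close>, so for \<open>2 * s \<le> card X\<close> it is too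
  small to obstruct. The set \<open>Z\<close> covers the boundary case \<open>2 * s = card X + 1\<close>, where a block
  would need both sides of size exactly \<open>s\<close>: then \<open>T\<close> is disjoint from \<open>Z\<close>, whose members are
  forbidden less often, and \<open>Y\<close> has no room for both.
\<close>

lemma bijection_avoiding_sparse_relation:
  assumes fin: "finite X" "finite Y" and card: "card X = card Y"
    and size: "2 * s \<le> card X + 1"
    and deg_X: "\<And>x. x \<in> X \<Longrightarrow> card {y \<in> Y. R x y} \<le> s"
    and deg_Y: "\<And>y. y \<in> Y \<Longrightarrow> card {x \<in> X. R x y} \<le> s"
    and Z: "Z \<subseteq> Y" "s \<le> card Z"
    and deg_Z: "\<And>y. y \<in> Z \<Longrightarrow> card {x \<in> X. R x y} < s"
  shows "\<exists>f. bij_betw f X Y \<and> (\<forall>x\<in>X. \<not> R x (f x))"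
proof (rule frobenius_koenig[OF fin card])
  fix S T assume ST: "S \<subseteq> X" "T \<subseteq> Y" and R: "\<And>x y. x \<in> S \<Longrightarrow> y \<in> T \<Longrightarrow> R x y"
  show "card S + card T \<le> card X"
  proof (rule ccontr)
    assume "\<not> ?thesis"
    then have big: "card S + card T \<ge> card X + 1" by simp
    have finST: "finite S" "finite T" using ST fin finite_subset by blast+
    have le: "card S \<le> card X" "card T \<le> card Y" using ST fin by (auto intro: card_mono)
    then have "card S \<noteq> 0" "card T \<noteq> 0" using big card by linarith+
    then obtain x0 y0 where "x0 \<in> S" "y0 \<in> T" by (metis card.empty ex_in_conv)
    have S_deg: "card S \<le> card {x \<in> X. R x y}" if "y \<in> T" for y
      using that R ST fin by (intro card_mono) auto
    have "card T \<le> card {y \<in> Y. R x0 y}" using \<open>x0 \<in> S\<close> R ST fin by (intro card_mono) auto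
    then have T_s: "card T \<le> s" using deg_X[of x0] \<open>x0 \<in> S\<close> ST by fastforce
    have "card S \<le> s" using S_deg[OF \<open>y0 \<in> T\<close>] deg_Y[of y0] \<open>y0 \<in> T\<close> ST by fastforce
    then have eq: "card S = s" "card T = s" "card X + 1 = 2 * s" using T_s big size by linarith+
    then have "T \<inter> Z = {}" using S_deg deg_Z by fastforce
    then have "card T + card Z = card (T \<union> Z)"
      using finST Z fin finite_subset by (metis card_Un_disjoint)
    also have "\<dots> \<le> card Y" using ST Z fin by (intro card_mono) auto
    finally show False using eq Z card by linarith
  qed
qed

section \<open>Regular graphs without triangles and 4-cycles\<close>

text \<open>
  The girth enters through two local conditions: adjacent vertices have no common neighbour, and
  distinct vertices have at most one.
\<close>

locale regular_girth5_graph =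
  fixes V :: "'a set" and E :: "'a \<Rightarrow> 'a \<Rightarrow> bool" and d :: nat
  assumes fin_V: "finite V"
    and edge_in_V: "E a b \<Longrightarrow> a \<in> V"
    and edge_sym: "E a b \<Longrightarrow> E b a"
    and degree: "a \<in> V \<Longrightarrow> card {b. E a b} = d"
    and no_triangle: "E a b \<Longrightarrow> E b c \<Longrightarrow> \<not> E a c"
    and no_square: "E a c \<Longrightarrow> E b c \<Longrightarrow> E a c' \<Longrightarrow> E b c' \<Longrightarrow> a \<noteq> b \<Longrightarrow> c = c'"
begin

definition nb :: "'a \<Rightarrow> 'a set" where "nb a = {b. E a b}"

lemma irrefl: "\<not> E a a"
  using no_triangle by blast

lemma nb_subset: "nb a \<subseteq> V"
  using edge_in_V edge_sym by (auto simp: nb_def)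

lemma finite_nb: "finite (nb a)"
  using nb_subset fin_V by (rule finite_subset)

lemma card_nb: "a \<in> V \<Longrightarrow> card (nb a) = d"
  by (simp add: nb_def degree)

lemma card_closed_nb: "a \<in> V \<Longrightarrow> card (insert a (nb a)) = d + 1"
  using irrefl[of a] by (simp add: finite_nb card_nb card_insert_if) (simp add: nb_def)

text \<open>
  A vertex has only \<open>d\<close> neighbours, which block at most \<open>d\<close> of the \<open>d + 1\<close> colors. Hence it suffices
  to color those vertices that decide which vertices become dominant.
\<close>

lemma greedy_extension:
  assumes "finite C" "card C = d + 1" and "D \<subseteq> V"
    and \<phi>: "\<phi> ` D \<subseteq> C" "\<And>a b. a \<in> D \<Longrightarrow> b \<in> D \<Longrightarrow> E a b \<Longrightarrow> \<phi> a \<noteq> \<phi> b"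
  shows "\<exists>\<psi>. \<psi> ` V \<subseteq> C \<and> (\<forall>a b. E a b \<longrightarrow> \<psi> a \<noteq> \<psi> b) \<and> (\<forall>a\<in>D. \<psi> a = \<phi> a)"
proof -
  have step: "\<exists>\<psi>. \<psi> ` (D \<union> L) \<subseteq> C \<and> (\<forall>a\<in>D \<union> L. \<forall>b\<in>D \<union> L. E a b \<longrightarrow> \<psi> a \<noteq> \<psi> b) \<and> (\<forall>a\<in>D. \<psi> a = \<phi> a)"
    if "finite L" "L \<subseteq> V - D" for L
    using that
  proof (induction L)
    case empty
    then show ?case using \<phi> by (intro exI[of _ \<phi>]) auto
  next
    case (insert z L)
    then obtain \<psi> where \<psi>: "\<psi> ` (D \<union> L) \<subseteq> C" "\<forall>a\<in>D. \<psi> a = \<phi> a"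
      and proper: "\<And>a b. a \<in> D \<union> L \<Longrightarrow> b \<in> D \<union> L \<Longrightarrow> E a b \<Longrightarrow> \<psi> a \<noteq> \<psi> b"
      by blast
    have "card (\<psi> ` nb z) \<le> d"
      using card_image_le[OF finite_nb] card_nb[of z] insert.prems by (metis DiffD1 insert_subset)
    then have "card (\<psi> ` nb z) < card C" using assms(2) by simp
    then have "\<not> C \<subseteq> \<psi> ` nb z"
      using finite_nb by (meson card_mono finite_imageI leD)
    then obtain t where t: "t \<in> C" "t \<notin> \<psi> ` nb z" by blast
    have z: "z \<notin> D \<union> L" using insert by blast
    have t': "t \<noteq> \<psi> b" if "E z b \<or> E b z" for b
      using t that edge_sym by (auto simp: nb_def)
    show ?case
    proof (intro exI[of _ "\<lambda>v. if v = z then t else \<psi> v"] conjI ballI impI)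
      show "(\<lambda>v. if v = z then t else \<psi> v) ` (D \<union> insert z L) \<subseteq> C"
        using \<psi>(1) t by auto
      show "(if a = z then t else \<psi> a) \<noteq> (if b = z then t else \<psi> b)"
        if "a \<in> D \<union> insert z L" "b \<in> D \<union> insert z L" "E a b" for a b
        using that proper t' irrefl by (metis Un_iff insert_iff)
      show "(if a = z then t else \<psi> a) = \<phi> a" if "a \<in> D" for a
        using that \<psi>(2) z by auto
    qed
  qed
  have eq: "D \<union> (V - D) = V" using assms(3) by blast
  have "finite (V - D)" using fin_V by simp
  from step[OF this subset_refl] show ?thesis
    unfolding eq using edge_in_V edge_sym by meson
qed

text \<open>
  A closed neighbourhood has as many vertices as there are colors, so a vertex is dominant as soon
  as no color is repeated on its closed neighbourhood.
\<close>

lemma rainbow_imp_dominating: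
  assumes "finite C" "card C = d + 1" and "a \<in> V" and "\<psi> ` V \<subseteq> C"
    and inj: "inj_on \<psi> (insert a (nb a))" and t: "t \<in> C" "t \<noteq> \<psi> a"
  shows "\<exists>b. E a b \<and> \<psi> b = t"
proof -
  have "\<psi> ` insert a (nb a) = C"
  proof (rule card_subset_eq)
    show "\<psi> ` insert a (nb a) \<subseteq> C" using assms nb_subset[of a] by blast
    show "card (\<psi> ` insert a (nb a)) = card C"
      using card_image[OF inj] card_closed_nb assms by simp
  qed fact
  then show ?thesis using t by (auto simp: nb_def)
qed

end

section \<open>Coloring the stars around the neighbours of a vertex\<close>

text \<open>
  The closed neighbourhood of the root \<open>x\<close> serves as the set of colors, and each of its vertices
  is its own color. This makes \<open>x\<close> dominant and turns \<open>insert x (nb x) - {a}\<close> into the set of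
  colors that a neighbour \<open>a\<close> of \<open>x\<close> has to see.
\<close>

locale rooted_regular_girth5_graph = regular_girth5_graph +
  fixes x :: 'a
  assumes x_in_V: "x \<in> V"
begin

definition N :: "'a \<Rightarrow> 'a set" where "N a = nb a - {x}"

text \<open>
  A proper coloring of the vertices at distance 2 from \<open>x\<close> that lie below \<open>J\<close>, under which every
  member of \<open>J\<close> becomes dominant: \<open>a\<close> sees the color \<open>x\<close> at \<open>x\<close> itself, and every other color
  but its own exactly once in \<open>N a\<close>.
\<close>

definition star_coloring :: "'a set \<Rightarrow> ('a \<Rightarrow> 'a) \<Rightarrow> bool" where
  "star_coloring J c \<longleftrightarrow> (\<forall>a\<in>J. bij_betw c (N a) (nb x - {a}))
     \<and> (\<forall>a\<in>J. \<forall>a'\<in>J. \<forall>b\<in>N a. \<forall>b'\<in>N a'. E b b' \<longrightarrow> c b \<noteq> c b')"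

lemma nb_xD: "a \<in> nb x \<Longrightarrow> E a x" "a \<in> nb x \<Longrightarrow> E x a" "a \<in> nb x \<Longrightarrow> a \<in> V"
  using edge_sym edge_in_V by (auto simp: nb_def)

lemma N_D: "b \<in> N a \<Longrightarrow> E a b" "b \<in> N a \<Longrightarrow> E b a" "b \<in> N a \<Longrightarrow> b \<noteq> x"
  using edge_sym by (auto simp: N_def nb_def)

lemma finite_N: "finite (N a)"
  by (simp add: N_def finite_nb)

lemma card_N: "a \<in> nb x \<Longrightarrow> card (N a) = d - 1"
  using nb_xD[of a] card_nb[of a] by (simp add: N_def finite_nb card_Diff_singleton nb_def)

lemma N_indep: "b \<in> N a \<Longrightarrow> b' \<in> N a \<Longrightarrow> \<not> E b b'"
  using N_D no_triangle by metis

text \<open>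
  Two neighbours of \<open>q\<close> in \<open>N a\<close> would close a 4-cycle with \<open>a\<close> and \<open>q\<close>. So the edges between two
  of the sets \<open>N a\<close> form a matching, which is the source of all degree bounds below.
\<close>

lemma N_unique_neighbor: "b \<in> N a \<Longrightarrow> b' \<in> N a \<Longrightarrow> E b q \<Longrightarrow> E b' q \<Longrightarrow> a \<noteq> q \<Longrightarrow> b = b'"
  using no_square[of a b q b'] N_D edge_sym by metis

lemma N_disjoint: "b \<in> N a \<Longrightarrow> b \<in> N a' \<Longrightarrow> a \<in> nb x \<Longrightarrow> a' \<in> nb x \<Longrightarrow> a = a'"
  using no_square[of a b a' x] N_D nb_xD by metis

lemma N_not_nb_x: "b \<in> N a \<Longrightarrow> a \<in> nb x \<Longrightarrow> b \<notin> nb x"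
  using N_D nb_xD no_triangle by metis

lemma star_coloring_bij: "star_coloring J c \<Longrightarrow> a \<in> J \<Longrightarrow> bij_betw c (N a) (nb x - {a})"
  by (simp add: star_coloring_def)

lemma star_coloring_proper:
  "star_coloring J c \<Longrightarrow> a \<in> J \<Longrightarrow> a' \<in> J \<Longrightarrow> b \<in> N a \<Longrightarrow> b' \<in> N a' \<Longrightarrow> E b b' \<Longrightarrow> c b \<noteq> c b'"
  by (simp add: star_coloring_def)

lemma star_coloring_inj: "star_coloring J c \<Longrightarrow> a \<in> J \<Longrightarrow> b \<in> N a \<Longrightarrow> b' \<in> N a \<Longrightarrow> c b = c b' \<Longrightarrow> b = b'"
  using star_coloring_bij by (metis bij_betw_imp_inj_on inj_onD)

lemma star_coloring_range: "star_coloring J c \<Longrightarrow> a \<in> J \<Longrightarrow> b \<in> N a \<Longrightarrow> c b \<in> nb x \<and> c b \<noteq> a"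
  using star_coloring_bij[of J c a] bij_betwE by blast

text \<open>
  The bijection on \<open>N z\<close> comes from \<open>bijection_avoiding_sparse_relation\<close> with \<open>s = card J\<close>: each set \<open>N a\<close>
  with \<open>a \<in> J\<close> forbids at most one color at a vertex of \<open>N z\<close> and forbids a given color at no more
  than one vertex. A color \<open>t \<in> J\<close> does not occur on \<open>N t\<close>, so it is forbidden less often,
  and \<open>J\<close> can play the part of \<open>Z\<close>. The colors \<open>g\<close> on \<open>P\<close> are prescribed in advance; they have
  to avoid \<open>J\<close> for that reason.
\<close>

lemma extend_star_coloring_by_one:
  assumes col: "star_coloring J c" and J: "J \<subseteq> nb x" and z: "z \<in> nb x" "z \<notin> J"
    and P: "P \<subseteq> N z" "inj_on g P" "g ` P \<subseteq> nb x - insert z J"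
    and compat: "\<And>p a b. p \<in> P \<Longrightarrow> a \<in> J \<Longrightarrow> b \<in> N a \<Longrightarrow> E b p \<Longrightarrow> c b \<noteq> g p"
    and size: "2 * card J \<le> card (N z - P) + 1"
  shows "\<exists>c'. star_coloring (insert z J) c' \<and> (\<forall>a\<in>J. \<forall>b\<in>N a. c' b = c b) \<and> (\<forall>p\<in>P. c' p = g p)"
proof -
  define R where "R b t \<longleftrightarrow> (\<exists>a\<in>J. \<exists>b'\<in>N a. E b' b \<and> c b' = t)" for b t
  define Y where "Y = (nb x - {z}) - g ` P"
  have finJ: "finite J" using J finite_nb finite_subset by blast
  have finP: "finite P" using P finite_N finite_subset by blast
  have "card (N z - P) = (d - 1) - card P"
    using P z finP by (simp add: card_Diff_subset card_N)
  moreover have "card Y = (d - 1) - card P"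
  proof -
    have "card Y = card (nb x - {z}) - card (g ` P)"
      unfolding Y_def using P finP by (intro card_Diff_subset) auto
    then show ?thesis using P z x_in_V by (simp add: card_image card_nb finite_nb)
  qed
  ultimately have card_eq: "card (N z - P) = card Y" by simp
  have "\<exists>f. bij_betw f (N z - P) Y \<and> (\<forall>b\<in>N z - P. \<not> R b (f b))"
  proof (rule bijection_avoiding_sparse_relation[where s = "card J" and Z = J])
    show "finite (N z - P)" "finite Y" by (auto simp: Y_def finite_N finite_nb)
    show "card (N z - P) = card Y" by (rule card_eq)
    show "2 * card J \<le> card (N z - P) + 1" by (rule size)
    show "card {t \<in> Y. R b t} \<le> card J" if b: "b \<in> N z - P" for b
    proof (rule card_le_if_inj_on_rel[OF finJ, where r = "\<lambda>t a. \<exists>b'\<in>N a. E b' b \<and> c b' = t"])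
      show "\<exists>a. a \<in> J \<and> (\<exists>b'\<in>N a. E b' b \<and> c b' = t)" if "t \<in> {t \<in> Y. R b t}" for t
        using that by (auto simp: R_def)
      show "t1 = t2" if "a \<in> J" "\<exists>b'\<in>N a. E b' b \<and> c b' = t1" "\<exists>b'\<in>N a. E b' b \<and> c b' = t2" for t1 t2 a
      proof -
        have "a \<noteq> b" using N_not_nb_x[of b z] b z J that(1) by blast
        then show ?thesis using N_unique_neighbor that by blast
      qed
    qed
    have deg: "card {b \<in> N z - P. R b t} \<le> card (J - {t})" for t
    proof (rule card_le_if_inj_on_rel[where r = "\<lambda>b a. \<exists>b'\<in>N a. E b' b \<and> c b' = t"])
      show "finite (J - {t})" using finJ by simp
      show "\<exists>a. a \<in> J - {t} \<and> (\<exists>b'\<in>N a. E b' b \<and> c b' = t)" if "b \<in> {b \<in> N z - P. R b t}" for b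
        using that star_coloring_range[OF col] by (auto simp: R_def)
      show "b1 = b2" if b12: "b1 \<in> {b \<in> N z - P. R b t}" "b2 \<in> {b \<in> N z - P. R b t}" "a \<in> J - {t}"
        "\<exists>b'\<in>N a. E b' b1 \<and> c b' = t" "\<exists>b'\<in>N a. E b' b2 \<and> c b' = t" for b1 b2 a
      proof -
        obtain b' where b': "b' \<in> N a" "E b' b1" "E b' b2"
          using b12 star_coloring_inj[OF col, of a] by (metis Diff_iff)
        have "z \<noteq> b'" using N_not_nb_x[of b' a] b' z J b12(3) by blast
        then show ?thesis using N_unique_neighbor[of b1 z b2 b'] b12 b' edge_sym by blast
      qed
    qed
    show "card {b \<in> N z - P. R b t} \<le> card J" if "t \<in> Y" for t
      using deg[of t] finJ by (meson Diff_subset card_mono le_trans)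
    show "card {b \<in> N z - P. R b t} < card J" if "t \<in> J" for t
      using deg[of t] that finJ by (meson card_Diff1_less le_less_trans)
    show "J \<subseteq> Y" using J z P by (auto simp: Y_def)
    show "card J \<le> card J" by simp
  qed
  then obtain f where f: "bij_betw f (N z - P) Y" "\<And>b. b \<in> N z - P \<Longrightarrow> \<not> R b (f b)" by blast
  define c' where "c' b = (if b \<in> P then g b else if b \<in> N z then f b else c b)" for b
  have c'_old: "c' b = c b" if "a \<in> J" "b \<in> N a" for a b
    using N_disjoint[of b a z] that J z P by (auto simp: c'_def)
  have bij_z: "bij_betw c' (N z) (nb x - {z})"
  proof -
    have "bij_betw c' (N z - P) Y"
      using f(1) by (rule bij_betw_cong[THEN iffD1, rotated]) (auto simp: c'_def)
    moreover have "bij_betw c' P (g ` P)"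
      using P by (auto simp: bij_betw_def inj_on_def c'_def)
    ultimately have "bij_betw c' ((N z - P) \<union> P) (Y \<union> g ` P)"
      by (rule bij_betw_combine) (auto simp: Y_def)
    moreover have "(N z - P) \<union> P = N z" "Y \<union> g ` P = nb x - {z}" using P by (auto simp: Y_def)
    ultimately show ?thesis by simp
  qed
  have cross: "c' b \<noteq> c' b'" if "a \<in> J" "b \<in> N a" "b' \<in> N z" "E b b'" for a b b'
  proof (cases "b' \<in> P")
    case True
    then show ?thesis using compat that c'_old by (simp add: c'_def)
  next
    case False
    then show ?thesis using f(2)[of b'] that c'_old by (auto simp: c'_def R_def)
  qed
  have "star_coloring (insert z J) c'"
    unfolding star_coloring_def
  proof (intro conjI ballI impI)
    fix a assume a: "a \<in> insert z J"
    show "bij_betw c' (N a) (nb x - {a})"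
    proof (cases "a = z")
      case False
      then have "a \<in> J" using a by simp
      then show ?thesis
        using star_coloring_bij[OF col] c'_old by (metis bij_betw_cong)
    qed (use bij_z in simp)
    fix a' b b' assume "a' \<in> insert z J" "b \<in> N a" "b' \<in> N a'" "E b b'"
    then show "c' b \<noteq> c' b'"
      using a cross[of a b b'] cross[of a' b' b] star_coloring_proper[OF col] c'_old N_indep edge_sym
      by (metis insert_iff)
  qed
  then show ?thesis using c'_old by (intro exI[of _ c']) (auto simp: c'_def)
qed

lemma extend_star_coloring:
  assumes "star_coloring I c" and "I \<subseteq> K" "K \<subseteq> nb x" and size: "2 * card K \<le> d + 2"
  shows "\<exists>c'. star_coloring K c' \<and> (\<forall>a\<in>I. \<forall>b\<in>N a. c' b = c b)"
proof -
  have finK: "finite K" using assms finite_nb finite_subset by blast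
  have "\<exists>c'. star_coloring (I \<union> L) c' \<and> (\<forall>a\<in>I. \<forall>b\<in>N a. c' b = c b)" if "finite L" "L \<subseteq> K - I" for L
    using that
  proof (induction L)
    case empty
    then show ?case using assms(1) by auto
  next
    case (insert z L)
    then obtain c1 where c1: "star_coloring (I \<union> L) c1" "\<forall>a\<in>I. \<forall>b\<in>N a. c1 b = c b" by blast
    have z: "z \<in> nb x" "z \<notin> I \<union> L" using insert assms by auto
    have "card (insert z (I \<union> L)) \<le> card K"
      using insert assms finK by (intro card_mono) auto
    then have "card (I \<union> L) + 1 \<le> card K"
      using z finK insert assms finite_subset by (metis Suc_eq_plus1 card_insert_disjoint finite_Un)
    moreover have "d \<ge> 1" using z x_in_V card_nb[of x] finite_nb[of x] by (metis One_nat_def Suc_leI card_gt_0_iff empty_iff)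
    ultimately have "2 * card (I \<union> L) \<le> card (N z - {}) + 1"
      using size z card_N by simp
    moreover have "I \<union> L \<subseteq> nb x" using assms insert by auto
    ultimately obtain c2 where "star_coloring (insert z (I \<union> L)) c2" "\<forall>a\<in>I \<union> L. \<forall>b\<in>N a. c2 b = c1 b"
      using extend_star_coloring_by_one[OF c1(1) _ z, where P = "{}" and g = id] by auto
    moreover have "I \<union> insert z L = insert z (I \<union> L)" by simp
    ultimately show ?case using c1(2) by (metis UnI1)
  qed
  from this[of "K - I"] show ?thesis using finK assms by (simp add: Un_absorb1)
qed

end

section \<open>A second pair of stars far from the first\<close>

text \<open>
  The vertex \<open>y\<close> has distance at least 5 from \<open>x\<close>. Excluding walks of length 3 and 4 is enough,
  because a shorter walk can be prolonged by going back and forth along an edge.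
  Consequently the neighbours of \<open>y\<close> have no edges to the sets \<open>N a\<close>, and the only interaction
  between the two regions is along edges between the sets \<open>N a\<close> and the neighbours of \<open>u\<close>
  other than \<open>y\<close>.
\<close>

locale distant_stars = rooted_regular_girth5_graph +
  fixes u y :: 'a
  assumes u_y: "E u y"
    and no_walk3: "E x a \<Longrightarrow> E a b \<Longrightarrow> \<not> E b y"
    and no_walk4: "E x a \<Longrightarrow> E a b \<Longrightarrow> E b b' \<Longrightarrow> \<not> E b' y"
    and degree_ge_7: "d \<ge> 7"
begin

definition M :: "'a set" where "M = nb u - {y}"

lemma y_u: "E y u" and u_in_V: "u \<in> V" and y_in_V: "y \<in> V"
  using u_y edge_sym edge_in_V by blast+

lemma some_nb_x: obtains a where "a \<in> nb x"
  using card_nb[OF x_in_V] degree_ge_7 by fastforce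

lemma no_walk2: "E x a \<Longrightarrow> \<not> E a y"
  using no_walk4[of a x a] edge_sym by blast

lemma no_walk1: "\<not> E x y"
  using no_walk3[of y x] edge_sym by blast

lemma x_not_y: "x \<noteq> y"
  using some_nb_x no_walk2 nb_xD by metis

lemma M_D: "w \<in> M \<Longrightarrow> E u w" "w \<in> M \<Longrightarrow> E w u" "w \<in> M \<Longrightarrow> w \<noteq> y" "w \<in> M \<Longrightarrow> w \<noteq> u"
  using edge_sym irrefl by (auto simp: M_def nb_def)

lemma finite_M: "finite M"
  by (simp add: M_def finite_nb)

lemma closed_nb_u: "insert u (nb u) = insert u (insert y M)"
  using u_y by (auto simp: M_def nb_def)

lemma N_not_adj_u: "b \<in> N a \<Longrightarrow> a \<in> nb x \<Longrightarrow> \<not> E b u \<and> b \<noteq> u"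
  using no_walk3 no_walk4 u_y N_D nb_xD by blast

lemma M_unique_neighbor:
  "b \<in> N a \<Longrightarrow> a \<in> nb x \<Longrightarrow> E b w \<Longrightarrow> E b w' \<Longrightarrow> w \<in> M \<Longrightarrow> w' \<in> M \<Longrightarrow> w = w'"
  using no_square[of b w u w'] M_D N_not_adj_u by metis

definition sees :: "'a set \<Rightarrow> ('a \<Rightarrow> 'a) \<Rightarrow> 'a \<Rightarrow> 'a \<Rightarrow> bool" where
  "sees K c w t \<longleftrightarrow> (\<exists>a\<in>K. \<exists>b\<in>N a. E b w \<and> c b = t)"

text \<open>
  The members of \<open>K\<close> at distance 2 from \<open>w\<close>, which bound the number of colors that \<open>w\<close> can see
  under any coloring.
\<close>

definition reach :: "'a set \<Rightarrow> 'a \<Rightarrow> 'a set" where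
  "reach K w = {a \<in> K. \<exists>b\<in>N a. E b w}"

lemma sees_range:
  assumes "star_coloring K c" "K \<subseteq> nb x" "sees K c w t"
  shows "t \<in> nb x"
  using assms star_coloring_range by (auto simp: sees_def)

lemma card_seen_colors:
  assumes K: "K \<subseteq> nb x" and w: "w \<in> M" and T: "\<And>t. t \<in> T \<Longrightarrow> sees K c w t"
  shows "card T \<le> card (reach K w)"
proof (rule card_le_if_inj_on_rel[where r = "\<lambda>t a. \<exists>b\<in>N a. E b w \<and> c b = t"])
  show "finite (reach K w)"
    by (rule finite_subset[OF _ finite_nb[of x]]) (use K in \<open>auto simp: reach_def\<close>)
  show "\<exists>a. a \<in> reach K w \<and> (\<exists>b\<in>N a. E b w \<and> c b = t)" if "t \<in> T" for t
    using T[OF that] by (auto simp: sees_def reach_def)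
  show "t1 = t2" if "a \<in> reach K w" "\<exists>b\<in>N a. E b w \<and> c b = t1" "\<exists>b\<in>N a. E b w \<and> c b = t2" for t1 t2 a
  proof -
    have "E x a" using that(1) K nb_xD by (auto simp: reach_def)
    then have "a \<noteq> w" using no_walk3[of a u] M_D[OF w] u_y by blast
    then show ?thesis using that N_unique_neighbor by blast
  qed
qed

text \<open>
  The color \<open>t\<close> occurs once in each \<open>N a\<close> with \<open>a \<in> K - {t}\<close>, and each occurrence has at most one
  neighbour in \<open>M\<close>. If the occurrences in the sets \<open>N a\<close> with \<open>a \<in> I\<close> are all adjacent to \<open>W0\<close>,
  they contribute nothing outside \<open>W0\<close>; this is how a clever choice of the coloring makes a color
  visible from fewer vertices.
\<close>

lemma card_seeing_vertices:
  assumes col: "star_coloring K c" and K: "K \<subseteq> nb x" and W: "W \<subseteq> M" "\<And>w. w \<in> W \<Longrightarrow> sees K c w t"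
    and I: "\<And>a. a \<in> I \<Longrightarrow> \<exists>b\<in>N a. c b = t \<and> (\<exists>w\<in>W0. E b w)" and W0: "W0 \<subseteq> M"
  shows "card (W - W0) \<le> card (K - insert t I)"
proof (rule card_le_if_inj_on_rel[where r = "\<lambda>w a. \<exists>b\<in>N a. E b w \<and> c b = t"])
  show "finite (K - insert t I)" using K finite_nb finite_subset by blast
  show "\<exists>a. a \<in> K - insert t I \<and> (\<exists>b\<in>N a. E b w \<and> c b = t)" if w: "w \<in> W - W0" for w
  proof -
    obtain a b where ab: "a \<in> K" "b \<in> N a" "E b w" "c b = t"
      using w W(2)[of w] unfolding sees_def by blast
    have "a \<noteq> t" using star_coloring_range[OF col] ab by blast
    moreover have "a \<notin> I"
    proof
      assume "a \<in> I"
      then obtain b' w' where b': "b' \<in> N a" "c b' = t" "w' \<in> W0" "E b' w'" using I by blast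
      then have "b' = b" using star_coloring_inj[OF col] ab by blast
      then have "w = w'" using M_unique_neighbor[of b a w w'] ab b' w W W0 K by blast
      then show False using w b' by blast
    qed
    ultimately show ?thesis using ab by blast
  qed
  show "w1 = w2" if w12: "w1 \<in> W - W0" "w2 \<in> W - W0" "a \<in> K - insert t I"
    "\<exists>b\<in>N a. E b w1 \<and> c b = t" "\<exists>b\<in>N a. E b w2 \<and> c b = t" for w1 w2 a
  proof -
    obtain b where b: "b \<in> N a" "E b w1" "E b w2"
      using w12 star_coloring_inj[OF col, of a] by (metis Diff_iff)
    then show ?thesis using M_unique_neighbor[of b a w1 w2] w12 W K by blast
  qed
qed

lemma card_seeing_vertices_le:
  assumes "star_coloring K c" and K: "K \<subseteq> nb x" and "W \<subseteq> M" "\<And>w. w \<in> W \<Longrightarrow> sees K c w t"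
  shows "card W \<le> card (K - {t})"
  using card_seeing_vertices[OF assms, of "{}" "{}"] by simp

text \<open>
  The star colorings under which \<open>u\<close> and \<open>y\<close> can become dominant too, with colors that differ
  from each other and from those of \<open>x\<close> and of \<open>K\<close>. Only the closed neighbourhood of \<open>u\<close>
  matters: the other neighbours of \<open>y\<close> are not adjacent to anything colored so far but \<open>y\<close>.
\<close>

definition completable :: "'a set \<Rightarrow> ('a \<Rightarrow> 'a) \<Rightarrow> bool" where
  "completable K c \<longleftrightarrow> (\<exists>f. bij_betw f (insert u (nb u)) (insert x (nb x))
     \<and> f u \<notin> insert x K \<and> f y \<notin> insert x K \<and> (\<forall>w\<in>M. \<not> sees K c w (f w)))"

text \<open>
  Demanding that the colors of \<open>u\<close> and \<open>y\<close> lie outside \<open>insert x K\<close>, instead of fixing them in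
  advance, leaves the choice of these two colors to the matching. A forbidden block inside \<open>M\<close> is
  excluded by the degree bounds as before. A block that involves \<open>u\<close> or \<open>y\<close> consists of colors in
  \<open>insert x K\<close>, hence in \<open>K\<close> as \<open>x\<close> is seen by no vertex of \<open>M\<close>; without \<open>u\<close> and \<open>y\<close> it is a block \<open>W \<times> T\<close>
  with \<open>card W + card T \<ge> d\<close>.
\<close>

lemma completable_if_no_block:
  assumes col: "star_coloring K c" and K: "K \<subseteq> nb x" and size: "2 * card K \<le> d + 2"
    and no_block: "\<And>W T. W \<subseteq> M \<Longrightarrow> T \<subseteq> K \<Longrightarrow> (\<And>w t. w \<in> W \<Longrightarrow> t \<in> T \<Longrightarrow> sees K c w t)
      \<Longrightarrow> W \<noteq> {} \<Longrightarrow> T \<noteq> {} \<Longrightarrow> card W + card T < d"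
  shows "completable K c"
proof -
  \<comment> \<open>\<open>R q t\<close> says that \<open>q\<close> must not receive the color \<open>t\<close>.\<close>
  define R where "R q t \<longleftrightarrow> (if q \<in> M then sees K c q t else t \<in> insert x K)" for q t
  have finK: "finite K" using K finite_nb finite_subset by blast
  have x_nb: "x \<notin> nb x" by (simp add: nb_def irrefl)
  have "\<exists>f. bij_betw f (insert u (nb u)) (insert x (nb x)) \<and> (\<forall>q\<in>insert u (nb u). \<not> R q (f q))"
  proof (rule frobenius_koenig)
    show "finite (insert u (nb u))" "finite (insert x (nb x))" by (simp_all add: finite_nb)
    show "card (insert u (nb u)) = card (insert x (nb x))"
      using card_closed_nb u_in_V x_in_V by metis
    fix S T assume S: "S \<subseteq> insert u (nb u)" and T: "T \<subseteq> insert x (nb x)"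
      and R: "\<And>q t. q \<in> S \<Longrightarrow> t \<in> T \<Longrightarrow> R q t"
    show "card S + card T \<le> card (insert u (nb u))"
    proof (rule ccontr)
      assume "\<not> ?thesis"
      then have big: "card S + card T \<ge> d + 2" using card_closed_nb[OF u_in_V] by linarith
      have finS: "finite S" using S finite_nb by (meson finite.insertI finite_subset)
      have finT: "finite T" using T finite_nb by (meson finite.insertI finite_subset)
      have S_le: "card S \<le> d + 1"
        using card_mono[OF _ S] card_closed_nb[OF u_in_V] finite_nb by simp
      have T_le: "card T \<le> d + 1"
        using card_mono[OF _ T] card_closed_nb[OF x_in_V] finite_nb by simp
      have "S \<noteq> {}" "T \<noteq> {}" using big S_le T_le by auto
      show False
      proof (cases "S \<subseteq> M")
        case True
        then have sees: "sees K c q t" if "q \<in> S" "t \<in> T" for q t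
          using R[OF that] that by (auto simp: R_def)
        obtain q where q: "q \<in> S" using \<open>S \<noteq> {}\<close> by blast
        have "card T \<le> card (reach K q)"
          using card_seen_colors[OF K] sees q True by blast
        also have "\<dots> \<le> card K" using finK by (intro card_mono) (auto simp: reach_def)
        finally have T_K: "card T \<le> card K" .
        have S_K: "card S \<le> card (K - {t})" if "t \<in> T" for t
          using card_seeing_vertices_le[OF col K True] sees that by blast
        obtain t0 where t0: "t0 \<in> T" using \<open>T \<noteq> {}\<close> by blast
        have "card (K - {t0}) \<le> card K" using finK by (intro card_mono) auto
        \<comment> \<open>All bounds are attained, so \<open>T\<close> avoids \<open>K\<close>, but \<open>nb x\<close> has no room for both.\<close>
        then have eq: "card S = card K" "card T = card K" "2 * card K = d + 2"
          using T_K S_K[OF t0] big size by linarith+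
        have "t \<notin> K" if "t \<in> T" for t
          using S_K[OF that] eq finK by (metis card_Diff1_less not_less)
        moreover have "T \<subseteq> nb x" using sees q sees_range[OF col K] by blast
        ultimately have "card (T \<union> K) = card T + card K" "T \<union> K \<subseteq> nb x"
          using finT finK K by (auto intro!: card_Un_disjoint)
        moreover from this have "card (T \<union> K) \<le> d"
          using card_mono[OF finite_nb] card_nb[OF x_in_V] by metis
        ultimately show False using eq by linarith
      next
        case False
        then obtain q where q: "q \<in> S" "q \<notin> M" by blast
        have T_sub: "T \<subseteq> insert x K" using R[OF q(1)] q by (auto simp: R_def)
        define W where "W = S \<inter> M"
        have "S \<subseteq> W \<union> {u, y}" using S by (auto simp: W_def M_def)
        then have "card S \<le> card (W \<union> {u, y})"
          using finS by (intro card_mono) (auto simp: W_def)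
        also have "\<dots> \<le> card W + card {u, y}" by (rule card_Un_le)
        finally have W_ge: "card S \<le> card W + 2"
          using card_insert_le_m1[of 2 "{y}" u] by (simp add: card_insert_if split: if_splits)
        have sees: "sees K c w t" if "w \<in> W" "t \<in> T" for w t
          using R[of w t] that by (auto simp: R_def W_def)
        have "card T \<le> card K + 1"
          using card_mono[OF _ T_sub] finK by (simp add: card_insert_if split: if_splits)
        then have "W \<noteq> {}" using W_ge big size degree_ge_7 by auto
        then have "x \<notin> T" using sees sees_range[OF col K] x_nb by blast
        then have "card W + card T < d"
          using no_block[of W T] T_sub sees \<open>W \<noteq> {}\<close> \<open>T \<noteq> {}\<close> by (auto simp: W_def)
        then show False using W_ge big by linarith
      qed
    qed
  qed
  then obtain f where "bij_betw f (insert u (nb u)) (insert x (nb x))"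
    and f: "\<And>q. q \<in> insert u (insert y M) \<Longrightarrow> \<not> R q (f q)"
    using closed_nb_u by metis
  moreover have "u \<notin> M" "y \<notin> M" using M_D by blast+
  moreover from this have "f u \<notin> insert x K" "f y \<notin> insert x K"
    using f[of u] f[of y] by (simp_all add: R_def)
  moreover have "\<not> sees K c w (f w)" if "w \<in> M" for w
    using f[of w] that by (simp add: R_def)
  ultimately show ?thesis unfolding completable_def by blast
qed

text \<open>
  In an obstructing block \<open>W \<times> T\<close> the set \<open>W\<close> has at least two and at most \<open>card K - 1\<close> elements,
  so \<open>card T > d - card K\<close>; all elements of \<open>W\<close> see \<open>T\<close> and hence reach as many sets \<open>N a\<close>.
\<close>

lemma completable_if_few_high_reach:
  assumes col: "star_coloring K c" and K: "K \<subseteq> nb x" and size: "2 * card K \<le> d + 2"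
    and few: "\<And>w w'. w \<in> M \<Longrightarrow> w' \<in> M \<Longrightarrow> w \<noteq> w'
      \<Longrightarrow> card (reach K w) + card K \<le> d \<or> card (reach K w') + card K \<le> d"
  shows "completable K c"
proof (rule completable_if_no_block[OF col K size])
  fix W T assume W: "W \<subseteq> M" "W \<noteq> {}" and T: "T \<subseteq> K" "T \<noteq> {}"
    and sees: "\<And>w t. w \<in> W \<Longrightarrow> t \<in> T \<Longrightarrow> sees K c w t"
  show "card W + card T < d"
  proof (rule ccontr)
    assume "\<not> ?thesis"
    then have big: "d \<le> card W + card T" by simp
    have finK: "finite K" using K finite_nb finite_subset by blast
    have T_K: "card T \<le> card K" using T finK by (simp add: card_mono)
    obtain t where t: "t \<in> T" using T by blast
    then have "card W \<le> card (K - {t})" using card_seeing_vertices_le[OF col K W(1)] sees by blast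
    then have W_K: "card W + 1 \<le> card K"
      using t T finK by (metis Suc_eq_plus1 Suc_leI card_Diff1_less le_less_trans subsetD)
    obtain w where w: "w \<in> W" using W by blast
    have "card W \<ge> 2" using big T_K size degree_ge_7 by linarith
    then have "W \<noteq> {w}" by auto
    then obtain w' where w': "w' \<in> W" "w \<noteq> w'" using w by blast
    have "card T \<le> card (reach K v)" if "v \<in> W" for v
      using card_seen_colors[OF K] W sees that by blast
    from this[OF w] this[OF w'(1)] show False
      using few[of w w'] w w' W big W_K by fastforce
  qed
qed

text \<open>
  The coloring is started on three sets \<open>N i1\<close>, \<open>N i2\<close>, \<open>N i3\<close> that both \<open>w\<close> and \<open>w'\<close> reach.
  The neighbours of \<open>w\<close> in them are pairwise nonadjacent, as they have a common neighbour, and may all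
  receive the same color \<open>j \<in> K\<close>. Likewise the neighbours of \<open>w'\<close> in \<open>N i1\<close> and \<open>N i2\<close> receive the color
  \<open>i3\<close>, which is available there. Then \<open>j\<close> is seen by at most \<open>card K - 3\<close> vertices of \<open>M\<close> and \<open>i3\<close> by at most
  \<open>card K - 2\<close>. So neither color fits into an obstructing block, and without these two colors the
  block is too small.
\<close>

lemma completable_if_shared_reach:
  assumes K: "K \<subseteq> nb x" and size: "2 * card K \<le> d + 2" "card K \<ge> 4"
    and w: "w \<in> M" "w' \<in> M" "w \<noteq> w'" and shared: "card (reach K w \<inter> reach K w') \<ge> 3"
  shows "\<exists>c. star_coloring K c \<and> completable K c"
proof -
  have finK: "finite K" using K finite_nb finite_subset by blast
  obtain I where "I \<subseteq> reach K w \<inter> reach K w'" "card I = 3"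
    using obtain_subset_with_card_n[OF shared] by blast
  then obtain i1 i2 i3 where i: "{i1, i2, i3} \<subseteq> reach K w \<inter> reach K w'"
    and i_neq: "i1 \<noteq> i2" "i1 \<noteq> i3" "i2 \<noteq> i3"
    by (metis card_3_iff)
  have i_K: "i1 \<in> K" "i2 \<in> K" "i3 \<in> K" using i by (auto simp: reach_def)
  then have i_nb: "i1 \<in> nb x" "i2 \<in> nb x" "i3 \<in> nb x" using K by blast+
  obtain p1 p2 p3 where p: "p1 \<in> N i1" "p2 \<in> N i2" "p3 \<in> N i3" "E p1 w" "E p2 w" "E p3 w"
    using i by (auto simp: reach_def)
  obtain q1 q2 where q: "q1 \<in> N i1" "q2 \<in> N i2" "E q1 w'" "E q2 w'"
    using i by (auto simp: reach_def)
  have pq: "p1 \<noteq> q1" "p2 \<noteq> q2"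
    using M_unique_neighbor[of _ _ w w'] p q w i_nb by metis+
  have indep: "\<not> E p1 p2" "\<not> E p1 p3" "\<not> E p2 p3" "\<not> E q1 q2"
    using p q no_triangle by blast+
  have "card {i1, i2, i3} = 3" using i_neq by simp
  then have "\<not> K \<subseteq> {i1, i2, i3}" using size(2) card_mono[of "{i1, i2, i3}" K] by fastforce
  then obtain j where j: "j \<in> K" "j \<noteq> i1" "j \<noteq> i2" "j \<noteq> i3" by blast
  then have j_nb: "j \<in> nb x" using K by blast
  \<comment> \<open>The sets with prescribed colors come first, where the size condition leaves some slack.\<close>
  have "star_coloring {} id" by (simp add: star_coloring_def)
  then have "\<exists>c. star_coloring {i1} c \<and> (\<forall>a\<in>{}. \<forall>b\<in>N a. c b = id b)
    \<and> (\<forall>v\<in>{p1, q1}. c v = (if v = p1 then j else i3))"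
    by (rule extend_star_coloring_by_one) (use i_nb j_nb i_neq j p q pq in \<open>auto simp: inj_on_def\<close>)
  then obtain c1 where c1: "star_coloring {i1} c1" "c1 p1 = j" "c1 q1 = i3" using pq by auto
  have c1_j: "b = p1" if "b \<in> N i1" "c1 b = j" for b
    using star_coloring_inj[OF c1(1), of i1 b p1] that p c1 by simp
  have c1_i3: "b = q1" if "b \<in> N i1" "c1 b = i3" for b
    using star_coloring_inj[OF c1(1), of i1 b q1] that q c1 by simp
  have "card {p2, q2} = 2" using pq by simp
  then have card2: "card (N i2 - {p2, q2}) = d - 3"
    using p q i_nb finite_N by (simp add: card_Diff_subset card_N)
  have "\<exists>c. star_coloring (insert i2 {i1}) c \<and> (\<forall>a\<in>{i1}. \<forall>b\<in>N a. c b = c1 b)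
    \<and> (\<forall>v\<in>{p2, q2}. c v = (if v = p2 then j else i3))"
  proof (rule extend_star_coloring_by_one[OF c1(1)])
    show "c1 b \<noteq> (if v = p2 then j else i3)" if "v \<in> {p2, q2}" "a \<in> {i1}" "b \<in> N a" "E b v" for v a b
      using that c1_j c1_i3 indep pq by (auto split: if_splits)
    show "2 * card {i1} \<le> card (N i2 - {p2, q2}) + 1" using card2 degree_ge_7 by simp
  qed (use i_nb j_nb i_neq j p q pq in \<open>auto simp: inj_on_def\<close>)
  then obtain c2 where c2: "star_coloring {i2, i1} c2" "c2 p2 = j" "c2 q2 = i3" "\<forall>b\<in>N i1. c2 b = c1 b"
    using pq by auto
  then have c2': "c2 p1 = j" "c2 q1 = i3" using c1 p q by auto
  have c2_j: "b \<in> {p1, p2}" if "b \<in> N i1 \<union> N i2" "c2 b = j" for b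
    using star_coloring_inj[OF c2(1), of i1 b p1] star_coloring_inj[OF c2(1), of i2 b p2] that p c2 c2' by auto
  have card3: "card (N i3 - {p3}) = d - 2"
    using p i_nb finite_N by (simp add: card_Diff_singleton card_N)
  have "\<exists>c. star_coloring (insert i3 {i2, i1}) c \<and> (\<forall>a\<in>{i2, i1}. \<forall>b\<in>N a. c b = c2 b)
    \<and> (\<forall>v\<in>{p3}. c v = j)"
  proof (rule extend_star_coloring_by_one[OF c2(1)])
    show "c2 b \<noteq> j" if "v \<in> {p3}" "a \<in> {i2, i1}" "b \<in> N a" "E b v" for v a b
      using that c2_j indep by blast
    show "2 * card {i2, i1} \<le> card (N i3 - {p3}) + 1" using card3 degree_ge_7 i_neq by simp
  qed (use i_nb j_nb i_neq j p in auto)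
  then obtain c3 where c3: "star_coloring {i3, i2, i1} c3" "c3 p3 = j"
    "\<forall>a\<in>{i2, i1}. \<forall>b\<in>N a. c3 b = c2 b" by auto
  obtain c where col: "star_coloring K c" and c: "\<forall>a\<in>{i3, i2, i1}. \<forall>b\<in>N a. c b = c3 b"
    using extend_star_coloring[OF c3(1) _ K size(1)] i_K by auto
  have c_pq: "c p1 = j" "c p2 = j" "c p3 = j" "c q1 = i3" "c q2 = i3"
    using c c3 c2 c2' p q by auto
  have "completable K c"
  proof (rule completable_if_no_block[OF col K size(1)])
    fix W T assume W: "W \<subseteq> M" and T: "T \<subseteq> K" "T \<noteq> {}"
      and sees: "\<And>v t. v \<in> W \<Longrightarrow> t \<in> T \<Longrightarrow> sees K c v t"
    have finW: "finite W" using W finite_M finite_subset by blast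
    have finT: "finite T" using T finK finite_subset by blast
    have minus: "card W \<le> card (W - {v}) + 1" for v
      using card_Diff1_le[of W v] finW by (cases "v \<in> W") (auto simp: card_Diff_singleton)
    show "card W + card T < d"
    proof (cases "j \<in> T")
      case True
      have "card (W - {w}) \<le> card (K - insert j {i1, i2, i3})"
        by (rule card_seeing_vertices[OF col K W]) (use sees True c_pq p w in blast)+
      also have "\<dots> = card K - 4"
        using finK i_K i_neq j by (subst card_Diff_subset) auto
      finally have "card W + 3 \<le> card K" using minus[of w] size(2) by linarith
      moreover have "card T \<le> card K" using T finK by (simp add: card_mono)
      ultimately show ?thesis using size(1) by linarith
    next
      case j_notin: False
      show ?thesis
      proof (cases "i3 \<in> T")
        case True
        have "card (W - {w'}) \<le> card (K - insert i3 {i1, i2})"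
          by (rule card_seeing_vertices[OF col K W]) (use sees True c_pq q w in blast)+
        also have "\<dots> = card K - 3"
          using finK i_K i_neq by (subst card_Diff_subset) auto
        finally have "card W + 2 \<le> card K" using minus[of w'] size(2) by linarith
        moreover have "card T \<le> card (K - {j})"
          using T finK j_notin by (intro card_mono) auto
        then have "card T + 1 \<le> card K"
          using j finK size(2) by (simp add: card_Diff_singleton)
        ultimately show ?thesis using size(1) by linarith
      next
        case False
        obtain t where t: "t \<in> T" using T by blast
        then have "card W \<le> card (K - {t})"
          using card_seeing_vertices_le[OF col K W] sees by blast
        then have "card W + 1 \<le> card K"
          using t T finK size(2) by (simp add: card_Diff_singleton subset_iff)
        moreover have "card T \<le> card (K - {j, i3})"
          using T finK j_notin False by (intro card_mono) auto
        then have "card T + 2 \<le> card K"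
          using j i_K finK size(2) by (simp add: card_Diff_subset)
        ultimately show ?thesis using size(1) by linarith
      qed
    qed
  qed
  then show ?thesis using col by blast
qed

text \<open>
  Two vertices of \<open>M\<close> that both reach more than \<open>d - card K\<close> of the \<open>card K\<close> sets \<open>N a\<close> reach at
  least three in common, by inclusion and exclusion; here \<open>d \<ge> 7\<close> is used.
\<close>

lemma exists_completable:
  obtains K c where "K \<subseteq> nb x" "card K = (d + 2) div 2" "star_coloring K c" "completable K c"
proof -
  have "(d + 2) div 2 \<le> card (nb x)" using card_nb[OF x_in_V] degree_ge_7 by simp
  then obtain K where K: "K \<subseteq> nb x" "card K = (d + 2) div 2" "finite K"
    using obtain_subset_with_card_n by blast
  have size: "2 * card K \<le> d + 2" "card K \<ge> 4" using K(2) degree_ge_7 by auto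
  have "\<exists>c. star_coloring K c \<and> completable K c"
  proof (cases "\<exists>w\<in>M. \<exists>w'\<in>M. w \<noteq> w' \<and> d < card (reach K w) + card K \<and> d < card (reach K w') + card K")
    case True
    then obtain w w' where w: "w \<in> M" "w' \<in> M" "w \<noteq> w'"
      and high: "d < card (reach K w) + card K" "d < card (reach K w') + card K" by blast
    have fin: "finite (reach K w)" "finite (reach K w')" using K(3) by (auto simp: reach_def)
    have "card (reach K w \<union> reach K w') \<le> card K"
      using K(3) by (intro card_mono) (auto simp: reach_def)
    then have "card (reach K w) + card (reach K w') \<le> card K + card (reach K w \<inter> reach K w')"
      using card_Un_Int[OF fin] by linarith
    then have "card (reach K w \<inter> reach K w') \<ge> 3"
      using high K(2) degree_ge_7 by presburger
    then show ?thesis using completable_if_shared_reach[OF K(1) size w] by blast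
  next
    case False
    have "star_coloring {} id" by (simp add: star_coloring_def)
    then obtain c where c: "star_coloring K c" using extend_star_coloring[OF _ _ K(1) size(1)] by blast
    have "completable K c"
    proof (rule completable_if_few_high_reach[OF c K(1) size(1)])
      show "card (reach K w) + card K \<le> d \<or> card (reach K w') + card K \<le> d"
        if "w \<in> M" "w' \<in> M" "w \<noteq> w'" for w w'
        using False that by (meson not_le)
    qed
    then show ?thesis using c by blast
  qed
  then show ?thesis using that K by blast
qed

text \<open>
  The dominant vertices are \<open>x\<close>, \<open>u\<close>, \<open>y\<close> and the members of \<open>K\<close>, and the colored part is the
  union of their closed neighbourhoods.
\<close>

lemma exists_partial_coloring_with_many_rainbow_stars:
  obtains D and \<phi> :: "'a \<Rightarrow> 'a" and S
  where "D \<subseteq> V" "\<phi> ` D \<subseteq> insert x (nb x)"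
    "\<forall>a\<in>D. \<forall>b\<in>D. E a b \<longrightarrow> \<phi> a \<noteq> \<phi> b"
    "inj_on \<phi> S" "card S = (d + 2) div 2 + 3"
    "\<forall>s\<in>S. insert s (nb s) \<subseteq> D \<and> inj_on \<phi> (insert s (nb s))"
proof -
  obtain K c where K: "K \<subseteq> nb x" "card K = (d + 2) div 2"
    and col: "star_coloring K c" and compl: "completable K c"
    by (rule exists_completable)
  from compl obtain f where f: "bij_betw f (insert u (nb u)) (insert x (nb x))"
    "f u \<notin> insert x K" "f y \<notin> insert x K" and unseen: "\<And>w. w \<in> M \<Longrightarrow> \<not> sees K c w (f w)"
    unfolding completable_def by blast
  define C where "C = insert x (nb x)"
  have finC: "finite C" and cardC: "card C = d + 1"
    using card_closed_nb[OF x_in_V] by (simp_all add: C_def finite_nb)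
  have x_nb: "x \<notin> nb x" by (simp add: nb_def irrefl)
  have finK: "finite K" using K finite_nb finite_subset by blast
  have f_inj: "inj_on f (insert u (nb u))" and f_C: "f ` insert u (nb u) = C"
    using f(1) by (auto simp: bij_betw_def C_def)
  have y_nb: "y \<in> nb u" and u_nb: "u \<in> nb y" using u_y y_u by (auto simp: nb_def)
  have u_neq_y: "u \<noteq> y" using u_y irrefl by blast
  have fuy: "f u \<noteq> f y" using f_inj y_nb u_neq_y by (auto dest: inj_onD)
  have fC: "f u \<in> C" "f y \<in> C" using f_C y_nb by auto
  have "card (nb y - {u}) = card (C - {f u, f y})"
    using card_nb[OF y_in_V] u_nb fuy fC finC cardC finite_nb by (simp add: card_Diff_subset)
  then obtain g where g: "bij_betw g (nb y - {u}) (C - {f u, f y})"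
    using finite_same_card_bij finC finite_nb by (metis finite_Diff)
  \<comment> \<open>\<open>NK\<close> and \<open>F\<close> are the vertices at distance 2 from \<open>x\<close> that matter and the far region.\<close>
  define NK where "NK = (\<Union>a\<in>K. N a)"
  define F where "F = insert u (nb u) \<union> nb y"
  define \<phi> where "\<phi> v = (if v \<in> C then v else if v \<in> NK then c v
    else if v \<in> insert u (nb u) then f v else g v)" for v
  define D where "D = C \<union> NK \<union> F"

  have C_cases: "v = x \<or> E x v" if "v \<in> C" for v using that by (auto simp: C_def nb_def)
  have NK_cases: "\<exists>a\<in>K. E x a \<and> E a v \<and> v \<in> N a" if "v \<in> NK" for v
    using that K nb_xD N_D unfolding NK_def by blast
  have F_cases: "v = u \<or> v = y \<or> v \<in> M \<or> v \<in> nb y - {u}" if "v \<in> F" for v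
    using that closed_nb_u by (auto simp: F_def)
  have NK_C: "v \<notin> C" if "v \<in> NK" for v
    using NK_cases[OF that] N_not_nb_x N_D(3) K unfolding C_def by blast
  have F_far: "\<not> (v = x \<or> E x v)" "\<not> (E x a \<and> E a v)" if "v \<in> F" for v a
  proof -
    consider "v = u" | "v = y" | "E v u" | "E v y"
      using \<open>v \<in> F\<close> edge_sym by (auto simp: F_def nb_def)
    then show "\<not> (v = x \<or> E x v)"
      using u_y no_walk1 no_walk2 no_walk3 x_not_y by cases blast+
    consider "v = u" | "v = y" | "E v u" | "E v y"
      using \<open>v \<in> F\<close> edge_sym by (auto simp: F_def nb_def)
    then show "\<not> (E x a \<and> E a v)"
      using u_y no_walk2 no_walk3 no_walk4 by cases blast+
  qed
  have F_disj: "v \<notin> C" "v \<notin> NK" if "v \<in> F" for v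
    using F_far[OF that] C_cases NK_cases by blast+
  have nb_y_nb_u: "v \<notin> insert u (nb u)" if "v \<in> nb y - {u}" for v
    using that u_y no_triangle by (auto simp: nb_def)
  have \<phi>_C: "\<phi> v = v" if "v \<in> C" for v using that by (simp add: \<phi>_def)
  have \<phi>_NK: "\<phi> v = c v" if "v \<in> NK" for v using that NK_C by (simp add: \<phi>_def)
  have \<phi>_u: "\<phi> v = f v" if "v \<in> insert u (nb u)" for v
  proof -
    have "v \<in> F" using that by (auto simp: F_def)
    then show ?thesis using F_disj[of v] that by (simp add: \<phi>_def)
  qed
  have \<phi>_y: "\<phi> v = g v" if "v \<in> nb y - {u}" for v
  proof -
    have "v \<in> F" using that by (auto simp: F_def)
    then show ?thesis using F_disj[of v] nb_y_nb_u[OF that] by (simp add: \<phi>_def)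
  qed
  have \<phi>_N: "\<phi> v = c v" if "a \<in> K" "v \<in> N a" for a v
    using that \<phi>_NK by (auto simp: NK_def)

  have D_V: "D \<subseteq> V"
    using nb_subset x_in_V u_in_V by (auto simp: D_def C_def NK_def N_def F_def)
  have c_C: "c v \<in> nb x" if "v \<in> NK" for v
    using that star_coloring_range[OF col] by (auto simp: NK_def)
  have g_C: "g v \<in> C - {f u, f y}" if "v \<in> nb y - {u}" for v using that g bij_betwE by blast
  have \<phi>_range: "\<phi> v \<in> C" if "v \<in> D" for v
  proof -
    from that consider "v \<in> C" | "v \<in> NK" | "v \<in> insert u (nb u)" | "v \<in> nb y - {u}"
      by (auto simp: D_def F_def)
    then show ?thesis
    proof cases
      case 3
      then show ?thesis using \<phi>_u[of v] f_C by blast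
    qed (use \<phi>_C \<phi>_NK \<phi>_y c_C g_C in \<open>auto simp: C_def\<close>)
  qed
  have proper_C_C: "\<phi> v \<noteq> \<phi> v'" if "E v v'" "v \<in> C" "v' \<in> C" for v v'
    using that \<phi>_C irrefl by metis
  have proper_C_NK: "\<phi> v \<noteq> \<phi> v'" if e: "E v v'" and v: "v \<in> C" "v' \<in> NK" for v v'
  proof
    assume eq: "\<phi> v = \<phi> v'"
    obtain a where a: "a \<in> K" "E x a" "E a v'" "v' \<in> N a" using NK_cases v(2) by blast
    have c: "c v' \<in> nb x" "c v' \<noteq> a" using star_coloring_range[OF col] a by blast+
    have "v = c v'" using eq \<phi>_C \<phi>_NK v by simp
    then have "v' = x"
      using c no_square[of a v' v x] a e nb_xD edge_sym by metis
    then show False using N_D a by blast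
  qed
  have proper_NK_NK: "\<phi> v \<noteq> \<phi> v'" if e: "E v v'" and v: "v \<in> NK" "v' \<in> NK" for v v'
    using e NK_cases[OF v(1)] NK_cases[OF v(2)] star_coloring_proper[OF col] \<phi>_NK v by metis
  have no_edge_C_F: "\<not> E v v'" if "v \<in> C" "v' \<in> F" for v v'
    using C_cases[OF that(1)] F_far[OF that(2)] by blast
  have proper_NK_F: "\<phi> v \<noteq> \<phi> v'" if e: "E v v'" and v: "v \<in> NK" "v' \<in> F" for v v'
  proof -
    obtain a where a: "a \<in> K" "E x a" "E a v" "v \<in> N a" using NK_cases v(1) by blast
    then have "\<not> E v u" "\<not> E v y" "\<not> E v' y" using N_not_adj_u K no_walk3 no_walk4 e by blast+
    then have M: "v' \<in> M" using F_cases[OF v(2)] e edge_sym by (auto simp: nb_def)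
    then have "f v' \<noteq> c v" using unseen[OF M] a e unfolding sees_def by metis
    then show ?thesis using \<phi>_u[of v'] \<phi>_NK[OF v(1)] M closed_nb_u by auto
  qed
  have proper_F_y: "\<phi> v \<noteq> \<phi> v'" if e: "E v v'" and v: "v \<in> F" "v' \<in> nb y - {u}" for v v'
  proof -
    have v': "E y v'" "E v' y" "v' \<noteq> u" using v edge_sym by (auto simp: nb_def)
    have "\<not> E u v'" using v' u_y no_triangle by blast
    moreover have "\<not> E y v \<or> v = y" using v' e no_triangle by blast
    moreover have "v \<notin> M" using no_square[of u v v' y] M_D[of v] v' u_y edge_sym e by metis
    ultimately have "v = y" using F_cases[OF v(1)] e v' by (auto simp: nb_def)
    then show ?thesis using \<phi>_u[of y] \<phi>_y[OF v(2)] y_nb g_C[OF v(2)] by auto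
  qed
  have proper_u_u: "\<phi> v \<noteq> \<phi> v'" if e: "E v v'" and v: "v \<in> insert u (nb u)" "v' \<in> insert u (nb u)" for v v'
    using f_inj v e irrefl \<phi>_u by (metis inj_onD)
  have proper_F_F: "\<phi> v \<noteq> \<phi> v'" if e: "E v v'" and v: "v \<in> F" "v' \<in> F" for v v'
  proof -
    consider "v' \<in> nb y - {u}" | "v \<in> nb y - {u}" | "v \<in> insert u (nb u)" "v' \<in> insert u (nb u)"
      using v by (auto simp: F_def)
    then show ?thesis
      using proper_F_y[OF e v(1)] proper_F_y[OF edge_sym[OF e] v(2)] proper_u_u[OF e]
      by cases metis+
  qed
  have \<phi>_proper: "\<phi> v \<noteq> \<phi> v'" if e: "E v v'" and v: "v \<in> D" "v' \<in> D" for v v'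
  proof -
    note e' = edge_sym[OF e]
    from v consider "v \<in> C" "v' \<in> C" | "v \<in> C" "v' \<in> NK" | "v \<in> C" "v' \<in> F"
      | "v \<in> NK" "v' \<in> C" | "v \<in> NK" "v' \<in> NK" | "v \<in> NK" "v' \<in> F"
      | "v \<in> F" "v' \<in> C" | "v \<in> F" "v' \<in> NK" | "v \<in> F" "v' \<in> F"
      unfolding D_def by blast
    then show ?thesis
      using e e' proper_C_C proper_C_NK proper_NK_NK no_edge_C_F proper_NK_F proper_F_F
      by cases metis+
  qed

  have inj_insert: "inj_on \<phi> (insert v A)" if "inj_on \<phi> A" "\<phi> v \<notin> \<phi> ` A" for v A
    using that by (simp add: inj_on_insert) blast
  define S where "S = {x, u, y} \<union> K"
  have rainbow_x: "inj_on \<phi> (insert x (nb x))"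
    using \<phi>_C by (auto simp: inj_on_def C_def)
  have rainbow_u: "inj_on \<phi> (insert u (nb u))"
    using f_inj \<phi>_u by (metis inj_on_cong)
  have rainbow_y: "inj_on \<phi> (insert y (nb y))"
  proof -
    have g_inj: "inj_on \<phi> (nb y - {u})"
      using g \<phi>_y by (metis bij_betw_def inj_on_cong)
    have im: "\<phi> ` (nb y - {u}) = C - {f u, f y}"
      using g \<phi>_y by (metis bij_betw_def image_cong)
    have "inj_on \<phi> (insert u (nb y - {u}))"
      by (rule inj_insert[OF g_inj]) (use im \<phi>_u[of u] in simp)
    moreover have "\<phi> ` insert u (nb y - {u}) = insert (f u) (C - {f u, f y})"
      using im \<phi>_u[of u] by (metis image_insert insertI1)
    then have "\<phi> y \<notin> \<phi> ` insert u (nb y - {u})"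
      using \<phi>_u[of y] y_nb fuy by simp
    ultimately have "inj_on \<phi> (insert y (insert u (nb y - {u})))"
      by (rule inj_insert)
    then show ?thesis using u_nb by (simp add: insert_absorb)
  qed
  have rainbow_K: "inj_on \<phi> (insert a (nb a))" if a: "a \<in> K" for a
  proof -
    have a_C: "a \<in> C" "x \<in> C" "a \<noteq> x" using a K x_nb by (auto simp: C_def)
    have bij: "bij_betw c (N a) (nb x - {a})" using star_coloring_bij[OF col a] .
    have inj: "inj_on \<phi> (N a)"
      using bij \<phi>_N[OF a] by (metis bij_betw_def inj_on_cong)
    have im: "\<phi> ` N a = nb x - {a}"
      using bij \<phi>_N[OF a] by (metis bij_betw_def image_cong)
    have "inj_on \<phi> (insert x (N a))"
      by (rule inj_insert[OF inj]) (use im \<phi>_C[OF a_C(2)] x_nb in simp)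
    moreover have "\<phi> a \<notin> \<phi> ` insert x (N a)"
      using im \<phi>_C[OF a_C(2)] \<phi>_C[OF a_C(1)] a_C(3) by auto
    ultimately have "inj_on \<phi> (insert a (insert x (N a)))"
      by (rule inj_insert)
    moreover have "x \<in> nb a" using nb_xD(1)[of a] a K by (simp add: nb_def subset_iff)
    then have "insert x (N a) = nb a" by (simp add: N_def insert_absorb)
    ultimately show ?thesis by simp
  qed
  have K_C: "K \<subseteq> C" "x \<notin> K" using K x_nb by (auto simp: C_def)
  have nb_K: "insert a (nb a) \<subseteq> D" if "a \<in> K" for a
    using that K by (auto simp: D_def C_def NK_def N_def)
  have closed: "insert s (nb s) \<subseteq> D \<and> inj_on \<phi> (insert s (nb s))" if "s \<in> S" for s
  proof -
    from that consider "s = x" | "s = u" | "s = y" | "s \<in> K" by (auto simp: S_def)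
    then show ?thesis
    proof cases
      case 4
      then show ?thesis using nb_K rainbow_K by blast
    qed (use rainbow_x rainbow_u rainbow_y y_nb in \<open>auto simp: D_def C_def F_def\<close>)
  qed
  have S_inj: "inj_on \<phi> S"
  proof -
    have "\<phi> x = x" "\<phi> u = f u" "\<phi> y = f y" "\<And>a. a \<in> K \<Longrightarrow> \<phi> a = a"
      using \<phi>_C \<phi>_u y_nb K_C by (auto simp: C_def)
    then show ?thesis
      using f fuy K_C unfolding S_def inj_on_def by auto
  qed
  have S_card: "card S = (d + 2) div 2 + 3"
  proof -
    have "u \<notin> C" "y \<notin> C" using F_disj y_nb by (auto simp: F_def)
    then have disj: "{x, u, y} \<inter> K = {}" and card3: "card {x, u, y} = 3"
      using K_C u_neq_y by (auto simp: C_def)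
    from disj have "card ({x, u, y} \<union> K) = card {x, u, y} + card K"
      using finK by (intro card_Un_disjoint) auto
    then show ?thesis unfolding S_def card3 K(2) by linarith
  qed
  show ?thesis
  proof (rule that[OF D_V _ _ S_inj S_card])
    show "\<phi> ` D \<subseteq> insert x (nb x)" using \<phi>_range by (auto simp: C_def)
    show "\<forall>a\<in>D. \<forall>b\<in>D. E a b \<longrightarrow> \<phi> a \<noteq> \<phi> b"
      using \<phi>_proper by blast
    show "\<forall>s\<in>S. insert s (nb s) \<subseteq> D \<and> inj_on \<phi> (insert s (nb s))"
      using closed by blast
  qed
qed

lemma exists_coloring_with_many_rainbow_stars:
  "\<exists>(\<psi> :: 'a \<Rightarrow> 'a) S. \<psi> ` V \<subseteq> insert x (nb x) \<and> (\<forall>a b. E a b \<longrightarrow> \<psi> a \<noteq> \<psi> b)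
     \<and> S \<subseteq> V \<and> (\<forall>s\<in>S. inj_on \<psi> (insert s (nb s))) \<and> inj_on \<psi> S \<and> card S = (d + 2) div 2 + 3"
proof -
  obtain D and \<phi> :: "'a \<Rightarrow> 'a" and S
    where \<phi>: "D \<subseteq> V" "\<phi> ` D \<subseteq> insert x (nb x)"
      "\<forall>a\<in>D. \<forall>b\<in>D. E a b \<longrightarrow> \<phi> a \<noteq> \<phi> b"
    and S: "inj_on \<phi> S" "card S = (d + 2) div 2 + 3"
      "\<forall>s\<in>S. insert s (nb s) \<subseteq> D \<and> inj_on \<phi> (insert s (nb s))"
    by (rule exists_partial_coloring_with_many_rainbow_stars)
  obtain \<psi> where \<psi>: "\<psi> ` V \<subseteq> insert x (nb x)" "\<forall>a b. E a b \<longrightarrow> \<psi> a \<noteq> \<psi> b" "\<forall>a\<in>D. \<psi> a = \<phi> a"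
    using greedy_extension[OF finite.insertI[OF finite_nb] card_closed_nb[OF x_in_V] \<phi>(1,2)] \<phi>(3)
    by blast
  have S_D: "S \<subseteq> D" using S(3) by blast
  have cong: "inj_on \<psi> A" if "inj_on \<phi> A" "A \<subseteq> D" for A
    using that \<psi>(3) by (metis inj_on_cong subsetD)
  have S_inj: "inj_on \<psi> S" using cong S(1) S_D by blast
  have rainbow: "\<forall>s\<in>S. inj_on \<psi> (insert s (nb s))" using cong S(3) by blast
  have S_V: "S \<subseteq> V" using S_D \<phi>(1) by (rule subset_trans)
  show ?thesis
    by (intro exI[of _ \<psi>] exI[of _ S] conjI) (fact \<psi> S_V rainbow S_inj S(2))+
qed

end

section \<open>Girth, diameter and dominant vertices\<close>

lemma (in wf_digraph) awalk_length_ge: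
  assumes "awalk a p b" and "ereal r < \<mu> (\<lambda>_. 1) a b"
  shows "r < real (length p)"
proof -
  have "awalk_cost (\<lambda>_. 1) p = real (length p)" by (induction p) auto
  then have "\<mu> (\<lambda>_. 1) a b \<le> ereal (real (length p))"
    using min_cost_le_walk_cost[OF assms(1), of "\<lambda>_. 1"] by simp
  then show ?thesis using assms(2) by (metis less_ereal.simps(1) less_le_trans)
qed

lemma girth_le_cycle_length:
  assumes "girth G = enat n" "pre_digraph.cycle G p" "3 \<le> length p"
  shows "n \<le> length p"
proof -
  have "girth G \<le> enat (length p)"
    unfolding girth_def by (rule INF_lower) (use assms in simp)
  then show ?thesis using assms(1) by simp
qed

lemma dominates_obtain_arc:
  assumes "a \<rightarrow>\<^bsub>G\<^esub> b"
  obtains e where "e \<in> arcs G" "tail G e = a" "head G e = b"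
  using assms by (auto simp: arcs_ends_def arc_to_ends_def)

lemma (in nomulti_digraph) card_dominated: "card {b. a \<rightarrow>\<^bsub>G\<^esub> b} = out_degree G a"
proof -
  have "inj_on (head G) (out_arcs G a)"
    by (rule inj_onI) (auto intro: no_multi_arcs simp: arc_to_ends_def)
  moreover have "head G ` out_arcs G a = {b. a \<rightarrow>\<^bsub>G\<^esub> b}"
    by (auto simp: arcs_ends_def arc_to_ends_def)
  ultimately show ?thesis unfolding out_degree_def by (metis card_image)
qed

text \<open>
  A triangle or a 4-cycle, run through as a closed walk, is a cycle of length 3 or 4.
\<close>

lemma (in graph) regular_girth5_graphI:
  assumes "regular d G" and girth: "girth G = 5"
  shows "regular_girth5_graph (verts G) (\<lambda>a b. a \<rightarrow>\<^bsub>G\<^esub> b) d"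
proof -
  have girth': "girth G = enat 5" using girth by (simp add: numeral_eq_enat)
  have sym: "b \<rightarrow>\<^bsub>G\<^esub> a" if "a \<rightarrow>\<^bsub>G\<^esub> b" for a b
    using that sym_arcs by (rule arcs_ends_symmetric[rotated])
  show ?thesis
  proof
    show "finite (verts G)" by simp
    show "a \<in> verts G" if "a \<rightarrow>\<^bsub>G\<^esub> b" for a b using that by (rule adj_in_verts)
    show "b \<rightarrow>\<^bsub>G\<^esub> a" if "a \<rightarrow>\<^bsub>G\<^esub> b" for a b using that by (rule sym)
    show "card {b. a \<rightarrow>\<^bsub>G\<^esub> b} = d" if "a \<in> verts G" for a
      using that assms(1) by (simp add: card_dominated regular_def)
    show "\<not> a \<rightarrow>\<^bsub>G\<^esub> c" if "a \<rightarrow>\<^bsub>G\<^esub> b" "b \<rightarrow>\<^bsub>G\<^esub> c" for a b c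
    proof
      assume "a \<rightarrow>\<^bsub>G\<^esub> c"
      then have "c \<rightarrow>\<^bsub>G\<^esub> a" by (rule sym)
      obtain e1 e2 e3 where e: "e1 \<in> arcs G" "tail G e1 = a" "head G e1 = b"
        "e2 \<in> arcs G" "tail G e2 = b" "head G e2 = c" "e3 \<in> arcs G" "tail G e3 = c" "head G e3 = a"
        using \<open>a \<rightarrow>\<^bsub>G\<^esub> b\<close> \<open>b \<rightarrow>\<^bsub>G\<^esub> c\<close> \<open>c \<rightarrow>\<^bsub>G\<^esub> a\<close> by (meson dominates_obtain_arc)
      have "awalk a [e1, e2, e3] a"
        using e by (auto simp: awalk_def)
      moreover have "a \<noteq> b" "b \<noteq> c" "a \<noteq> c"
        using \<open>a \<rightarrow>\<^bsub>G\<^esub> b\<close> \<open>b \<rightarrow>\<^bsub>G\<^esub> c\<close> \<open>a \<rightarrow>\<^bsub>G\<^esub> c\<close> adj_not_same by blast+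
      ultimately have "cycle [e1, e2, e3]"
        using e unfolding cycle_def by (intro exI[of _ a]) auto
      then show False using girth_le_cycle_length[OF girth'] by fastforce
    qed
    show "c = c'" if "a \<rightarrow>\<^bsub>G\<^esub> c" "b \<rightarrow>\<^bsub>G\<^esub> c" "a \<rightarrow>\<^bsub>G\<^esub> c'" "b \<rightarrow>\<^bsub>G\<^esub> c'" "a \<noteq> b" for a b c c'
    proof (rule ccontr)
      assume "c \<noteq> c'"
      have "c \<rightarrow>\<^bsub>G\<^esub> b" "c' \<rightarrow>\<^bsub>G\<^esub> a" using that sym by blast+
      obtain e1 e2 e3 e4 where e: "e1 \<in> arcs G" "tail G e1 = a" "head G e1 = c"
        "e2 \<in> arcs G" "tail G e2 = c" "head G e2 = b" "e3 \<in> arcs G" "tail G e3 = b" "head G e3 = c'"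
        "e4 \<in> arcs G" "tail G e4 = c'" "head G e4 = a"
        using \<open>a \<rightarrow>\<^bsub>G\<^esub> c\<close> \<open>c \<rightarrow>\<^bsub>G\<^esub> b\<close> \<open>b \<rightarrow>\<^bsub>G\<^esub> c'\<close> \<open>c' \<rightarrow>\<^bsub>G\<^esub> a\<close> by (meson dominates_obtain_arc)
      have "awalk a [e1, e2, e3, e4] a"
        using e by (auto simp: awalk_def)
      moreover have "a \<noteq> c" "b \<noteq> c" "a \<noteq> c'" "b \<noteq> c'"
        using that adj_not_same by blast+
      ultimately have "cycle [e1, e2, e3, e4]"
        using e \<open>a \<noteq> b\<close> \<open>c \<noteq> c'\<close> unfolding cycle_def by (intro exI[of _ a]) auto
      then show False using girth_le_cycle_length[OF girth'] by fastforce
    qed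
  qed
qed

lemma (in graph) distant_starsI:
  assumes "regular d G" and "girth G = 5" and d: "d \<ge> 7"
    and xy: "x \<in> verts G" "y \<in> verts G" "ereal 4 < \<mu> (\<lambda>_. 1) x y" and u: "y \<rightarrow>\<^bsub>G\<^esub> u"
  shows "distant_stars (verts G) (\<lambda>a b. a \<rightarrow>\<^bsub>G\<^esub> b) d x u y"
proof -
  interpret regular_girth5_graph "verts G" "\<lambda>a b. a \<rightarrow>\<^bsub>G\<^esub> b" d
    using assms by (intro regular_girth5_graphI)
  have long: "4 < length p" if "awalk x p y" for p
    using awalk_length_ge[OF that xy(3)] by simp
  show ?thesis
  proof
    show "x \<in> verts G" by (fact xy(1))
    show "u \<rightarrow>\<^bsub>G\<^esub> y" using u by (rule edge_sym)
    show "d \<ge> 7" by (fact d)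
    show "\<not> b \<rightarrow>\<^bsub>G\<^esub> y" if walk: "x \<rightarrow>\<^bsub>G\<^esub> a" "a \<rightarrow>\<^bsub>G\<^esub> b" for a b
    proof
      assume "b \<rightarrow>\<^bsub>G\<^esub> y"
      then obtain e1 e2 e3 where "e1 \<in> arcs G" "tail G e1 = x" "head G e1 = a"
        "e2 \<in> arcs G" "tail G e2 = a" "head G e2 = b" "e3 \<in> arcs G" "tail G e3 = b" "head G e3 = y"
        using walk by (meson dominates_obtain_arc)
      then have "awalk x [e1, e2, e3] y" using xy by (simp add: awalk_def)
      from long[OF this] show False by simp
    qed
    show "\<not> b' \<rightarrow>\<^bsub>G\<^esub> y" if walk: "x \<rightarrow>\<^bsub>G\<^esub> a" "a \<rightarrow>\<^bsub>G\<^esub> b" "b \<rightarrow>\<^bsub>G\<^esub> b'" for a b b'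
    proof
      assume "b' \<rightarrow>\<^bsub>G\<^esub> y"
      then obtain e1 e2 e3 e4 where "e1 \<in> arcs G" "tail G e1 = x" "head G e1 = a"
        "e2 \<in> arcs G" "tail G e2 = a" "head G e2 = b" "e3 \<in> arcs G" "tail G e3 = b" "head G e3 = b'"
        "e4 \<in> arcs G" "tail G e4 = b'" "head G e4 = y"
        using walk by (meson dominates_obtain_arc)
      then have "awalk x [e1, e2, e3, e4] y" using xy by (simp add: awalk_def)
      from long[OF this] show False by simp
    qed
  qed
qed

lemma f_chromatic_vertex_number_ge:
  assumes "finite (verts G)" and "proper_coloring G (d + 1) c"
    and "\<forall>v\<in>S. dominant G (d + 1) c v" and "inj_on c S"
  shows "card S \<le> f_chromatic_vertex_number d G"
proof -
  define A where "A = {card S | S c. proper_coloring G (d + 1) c \<and>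
       (\<forall>v\<in>S. dominant G (d + 1) c v) \<and> inj_on c S}"
  have "A \<subseteq> card ` Pow (verts G)" by (auto simp: A_def dominant_def)
  then have "finite A" using assms(1) by (meson finite_Pow_iff finite_imageI finite_subset)
  moreover have "card S \<in> A" using assms unfolding A_def by blast
  ultimately show ?thesis unfolding f_chromatic_vertex_number_def A_def by (rule Max_ge)
qed

lemma (in regular_girth5_graph) relabel_dominant:
  assumes C: "finite C" "card C = d + 1" and h: "bij_betw h C {..<d + 1}"
    and \<psi>: "\<psi> ` V \<subseteq> C" and s: "s \<in> V" "inj_on \<psi> (insert s (nb s))"
    and i: "i < d + 1" "i \<noteq> h (\<psi> s)"
  shows "\<exists>w. E s w \<and> h (\<psi> w) = i"
proof -
  obtain t where t: "t \<in> C" "h t = i" using h i by (metis bij_betw_iff_bijections lessThan_iff)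
  then have "t \<noteq> \<psi> s" using i by blast
  then show ?thesis using rainbow_imp_dominating[OF C s(1) \<psi> s(2) t(1)] t(2) by blast
qed

theorem theorem3p1:
  fixes G :: "('a, 'b) pre_digraph" and d :: nat
  assumes "graph G"
    and "regular d G"
    and "d \<ge> 7"
    and "girth G = 5"
    and "diam G = 5"
  shows "int (f_chromatic_vertex_number d G) \<ge> \<lceil>(real d - 1) / 2\<rceil> + 4"
proof -
  interpret graph G by fact
  interpret regular_girth5_graph "verts G" "\<lambda>a b. a \<rightarrow>\<^bsub>G\<^esub> b" d
    using assms by (intro regular_girth5_graphI)
  have "ereal 4 < diam G" using assms(5) by simp
  then obtain x y where xy: "x \<in> verts G" "y \<in> verts G" "ereal 4 < \<mu> (\<lambda>_. 1) x y"
    unfolding diam_def less_SUP_iff by auto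
  have "nb y \<noteq> {}" using card_nb[OF xy(2)] assms(3) by auto
  then obtain u where u: "y \<rightarrow>\<^bsub>G\<^esub> u" by (auto simp: nb_def)
  interpret distant_stars "verts G" "\<lambda>a b. a \<rightarrow>\<^bsub>G\<^esub> b" d x u y
    using assms xy u by (intro distant_starsI)
  obtain \<psi> :: "'a \<Rightarrow> 'a" and S where \<psi>: "\<psi> ` verts G \<subseteq> insert x (nb x)"
      "\<forall>a b. a \<rightarrow>\<^bsub>G\<^esub> b \<longrightarrow> \<psi> a \<noteq> \<psi> b"
    and S: "S \<subseteq> verts G" "\<forall>s\<in>S. inj_on \<psi> (insert s (nb s))" "inj_on \<psi> S"
      "card S = (d + 2) div 2 + 3"
    using exists_coloring_with_many_rainbow_stars by (elim exE conjE) (rule that)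
  have C: "finite (insert x (nb x))" "card (insert x (nb x)) = d + 1"
    using card_closed_nb[OF x_in_V] finite_nb by auto
  obtain h where h: "bij_betw h (insert x (nb x)) {..<d + 1}"
    using finite_same_card_bij[OF C(1), of "{..<d + 1}"] C(2) by auto
  have h_lt: "h (\<psi> a) < d + 1" if "a \<in> verts G" for a
    using bij_betw_apply[OF h, of "\<psi> a"] \<psi>(1) that by blast
  have h_inj: "h (\<psi> a) = h (\<psi> b) \<Longrightarrow> \<psi> a = \<psi> b" if "a \<in> verts G" "b \<in> verts G" for a b
    using bij_betw_imp_inj_on[OF h] \<psi>(1) that by (meson image_subset_iff inj_onD)
  have "proper_coloring G (d + 1) (h \<circ> \<psi>)"
    unfolding proper_coloring_def
  proof (intro conjI ballI allI impI)
    show "(h \<circ> \<psi>) v < d + 1" if "v \<in> verts G" for v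
      using h_lt[OF that] by simp
    show "(h \<circ> \<psi>) a \<noteq> (h \<circ> \<psi>) b" if "a \<rightarrow>\<^bsub>G\<^esub> b" for a b
      using h_inj[of a b] \<psi>(2) that edge_in_V edge_sym by fastforce
  qed
  moreover have "\<forall>s\<in>S. dominant G (d + 1) (h \<circ> \<psi>) s"
    unfolding dominant_def using relabel_dominant[OF C h \<psi>(1)] S(1,2) by fastforce
  moreover have "inj_on (h \<circ> \<psi>) S"
    using S(1,3) h_inj unfolding inj_on_def comp_def by (metis subsetD)
  ultimately have "card S \<le> f_chromatic_vertex_number d G"
    using f_chromatic_vertex_number_ge finite_verts by blast
  moreover have "\<lceil>(real d - 1) / 2\<rceil> \<le> int (d div 2)"
  proof -
    have "real d \<le> 2 * real (d div 2) + 1" by linarith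
    then show ?thesis by (simp add: ceiling_le_iff)
  qed
  ultimately show ?thesis using S(4) by linarith
qed

end
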